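(* Let $G$ be a graph on $n$ vertices with adjacency matrix $A$ and let $k\le n$ be a positive integer. Let $\lambda=\frac12(k-1)$ and $\mu=k$. Then: (i) If $x^*\in\{0,1\}^n$ is an optimal solution of (SkS), then $$\frac12 x^{*T}Ax^* < \frac12 x^TAx+\lambda(k-e^Tx)+\frac{\mu}{2}(e^Tx-k)^2$$ for all $x\in\{0,1\}^n$ with $e^Tx\neq k$. (ii) Any optimal solution of (SkS-AL) with these $\lambda,\mu$ is an optimal solution of (SkS).
   Context: Graphs are simple, undirected and finite, with vertex set $\{1,\dots,n\}$; $A$ is the adjacency matrix of $G$ and $e$ is the all-ones vector of length $n$. The sparsest $k$-subgraph problem is $$\text{(SkS)}\qquad \min\left\{\tfrac12 x^TAx \mid e^Tx=k,\ x\in\{0,1\}^n\right\}.$$ Its augmented Lagrangian relaxation with parameters $\lambda\in\mathbb{R}$, $\mu>0$ is $$\text{(SkS-AL)}\qquad \min\left\{\tfrac12 x^TAx+\lambda(k-e^Tx)+\tfrac{\mu}{2}(e^Tx-k)^2 \mid x\in\{0,1\}^n\right\}.$$ *)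

theory Defs
  imports Complex_Main "Graph_Theory.Pair_Digraph" "Jordan_Normal_Form.Matrix"
begin

text \<open>A simple undirected graph is a finite, loop-free, symmetric pair digraph (locale
  \<^locale>\<open>pair_graph\<close>); its vertices are \<open>{1..n}\<close>, so they are shifted by one to
  match the row and column indices \<open>0, \<dots>, n - 1\<close>.\<close>

definition adjacency_matrix :: "nat \<Rightarrow> nat pair_pre_digraph \<Rightarrow> real mat" where
  "adjacency_matrix n G = mat n n (\<lambda>(i, j). if (Suc i, Suc j) \<in> parcs G then 1 else 0)"

definition ones_vec :: "nat \<Rightarrow> real vec" where
  "ones_vec n = vec n (\<lambda>_. 1)"

definition binary_vecs :: "nat \<Rightarrow> real vec set" where
  "binary_vecs n = {x \<in> carrier_vec n. \<forall>i<n. x $ i \<in> {0, 1}}"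

definition sks_obj :: "real mat \<Rightarrow> real vec \<Rightarrow> real" where
  "sks_obj A x = 1 / 2 * (x \<bullet> (A *\<^sub>v x))"

definition sks_al_obj :: "nat \<Rightarrow> real mat \<Rightarrow> nat \<Rightarrow> real \<Rightarrow> real \<Rightarrow> real vec \<Rightarrow> real" where
  "sks_al_obj n A k lam mu x =
     1 / 2 * (x \<bullet> (A *\<^sub>v x)) + lam * (real k - ones_vec n \<bullet> x)
       + mu / 2 * (ones_vec n \<bullet> x - real k)\<^sup>2"

definition sks_optimal :: "nat \<Rightarrow> real mat \<Rightarrow> nat \<Rightarrow> real vec \<Rightarrow> bool" where
  "sks_optimal n A k x \<longleftrightarrow>
     is_arg_min (sks_obj A) (\<lambda>y. y \<in> binary_vecs n \<and> ones_vec n \<bullet> y = real k) x"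

definition sks_al_optimal :: "nat \<Rightarrow> real mat \<Rightarrow> nat \<Rightarrow> real \<Rightarrow> real \<Rightarrow> real vec \<Rightarrow> bool" where
  "sks_al_optimal n A k lam mu x \<longleftrightarrow>
     is_arg_min (sks_al_obj n A k lam mu) (\<lambda>y. y \<in> binary_vecs n) x"

end

theory Submission
  imports Defs "HOL-Library.Indicator_Function"
begin

text \<open>Write a binary vector as the indicator of a vertex set \<open>S\<close> with \<open>m\<close> elements. If \<open>m > k\<close>, delete
  vertices until \<open>k\<close> are left: the number of edges does not grow, while the penalty is positive.
  If \<open>m < k\<close>, add \<open>d = k - m\<close> vertices: this creates at most \<open>d (k + m - 1) / 2\<close> edges, which is less
  than the penalty \<open>d (k - 1 + k d) / 2\<close>. So every infeasible point is strictly
  beaten by a feasible one, and both claims follow.\<close>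

text \<open>Here \<open>S\<close> holds matrix indices, so \<open>i\<close> stands for the vertex
  \<open>Suc i\<close>. Elements outside \<open>{..<n}\<close> are lost, whence the later
  assumptions \<open>S \<subseteq> {..<n}\<close>.\<close>

definition indicator_vec :: "nat \<Rightarrow> nat set \<Rightarrow> real vec" where
  "indicator_vec n S = vec n (indicator S)"

lemma indicator_vec_in_binary_vecs: "indicator_vec n S \<in> binary_vecs n"
  by (auto simp: indicator_vec_def binary_vecs_def indicator_def)

lemma binary_vecs_cases:
  assumes "x \<in> binary_vecs n"
  obtains S where "S \<subseteq> {..<n}" and "x = indicator_vec n S"
proof
  show "{i. i < n \<and> x $ i = 1} \<subseteq> {..<n}"
    by auto
  show "x = indicator_vec n {i. i < n \<and> x $ i = 1}"
    using assms by (intro eq_vecI) (auto simp: indicator_vec_def binary_vecs_def indicator_def)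
qed

lemma ones_vec_scalar_prod_indicator_vec:
  assumes "S \<subseteq> {..<n}"
  shows "ones_vec n \<bullet> indicator_vec n S = real (card S)"
proof -
  have "ones_vec n \<bullet> indicator_vec n S = (\<Sum>i\<in>{0..<n}. indicator S i)"
    by (simp add: ones_vec_def indicator_vec_def scalar_prod_def)
  also have "\<dots> = (\<Sum>i\<in>S. 1)"
    using assms by (intro sum.mono_neutral_cong_right) (auto simp: indicator_def)
  finally show ?thesis
    by simp
qed

text \<open>For an adjacency matrix the sum runs over ordered pairs and counts each edge inside
  \<open>S\<close> twice; the factor 1/2 in the objective compensates.\<close>

lemma quadratic_form_indicator_vec:
  fixes A :: "real mat"
  assumes "A \<in> carrier_mat n n" and "S \<subseteq> {..<n}"
  shows "indicator_vec n S \<bullet> (A *\<^sub>v indicator_vec n S) = (\<Sum>p\<in>S \<times> S. A $$ p)"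
proof -
  have "indicator_vec n S \<bullet> (A *\<^sub>v indicator_vec n S)
      = (\<Sum>i\<in>{0..<n}. indicator S i * (\<Sum>j\<in>{0..<n}. A $$ (i, j) * indicator S j))"
    using assms(1) by (simp add: indicator_vec_def scalar_prod_def)
  also have "\<dots> = (\<Sum>i\<in>S. \<Sum>j\<in>{0..<n}. A $$ (i, j) * indicator S j)"
    using assms(2) by (intro sum.mono_neutral_cong_right) (auto simp: indicator_def)
  also have "\<dots> = (\<Sum>i\<in>S. \<Sum>j\<in>S. A $$ (i, j))"
    using assms(2)
    by (intro sum.cong[OF refl] sum.mono_neutral_cong_right) (auto simp: indicator_def)
  finally show ?thesis
    by (simp add: sum.cartesian_product)
qed

lemma sum_off_diagonal:
  assumes "finite S"
  shows "(\<Sum>(i, j)\<in>S \<times> S. of_bool (i \<noteq> j)) = (real (card S))\<^sup>2 - real (card S)"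
proof -
  have "(\<Sum>j\<in>S. of_bool (i \<noteq> j)) = real (card S) - 1" if "i \<in> S" for i
  proof -
    have "(\<Sum>j\<in>S. of_bool (i \<noteq> j)) = (\<Sum>j\<in>S. 1 - (if i = j then 1 else 0 :: real))"
      by (intro sum.cong) auto
    then show ?thesis
      using assms that by (simp add: sum_subtractf)
  qed
  then have "(\<Sum>i\<in>S. \<Sum>j\<in>S. of_bool (i \<noteq> j)) = real (card S) * (real (card S) - 1)"
    by simp
  then show ?thesis
    by (simp add: sum.cartesian_product power2_eq_square algebra_simps)
qed

text \<open>The shortfall \<open>g\<close> of \<open>f\<close> from the complete graph is
  nonnegative, so its sum can only grow from \<open>S \<times> S\<close> to
  \<open>T \<times> T\<close>. The complete graph thus gains the most.\<close>

lemma sum_square_growth: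
  fixes f :: "'a \<times> 'a \<Rightarrow> real"
  assumes "finite T" and "S \<subseteq> T"
    and "\<And>i j. i \<in> T \<Longrightarrow> j \<in> T \<Longrightarrow> f (i, j) \<le> of_bool (i \<noteq> j)"
  shows "(\<Sum>p\<in>T \<times> T. f p) - (\<Sum>p\<in>S \<times> S. f p)
       \<le> ((real (card T))\<^sup>2 - real (card T)) - ((real (card S))\<^sup>2 - real (card S))"
proof -
  define g where "g = (\<lambda>(i, j). of_bool (i \<noteq> j) - f (i, j))"
  have "(\<Sum>p\<in>S \<times> S. g p) \<le> (\<Sum>p\<in>T \<times> T. g p)"
    using assms by (intro sum_mono2) (auto simp: g_def)
  moreover have "(\<Sum>p\<in>U \<times> U. g p) = ((real (card U))\<^sup>2 - real (card U)) - (\<Sum>p\<in>U \<times> U. f p)"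
    if "finite U" for U
    using sum_off_diagonal[OF that] by (simp add: g_def case_prod_unfold sum_subtractf)
  ultimately show ?thesis
    using assms(1) finite_subset[OF assms(2,1)] by simp
qed

text \<open>With \<open>d = m - k\<close> the penalty factors as
  \<open>d / 2 * (k * d - (k - 1))\<close>. Its least possible value, 1/2, occurs at
  \<open>d = 1\<close>.\<close>

lemma penalty_beats_deletion:
  fixes k m :: nat
  assumes "k < m"
  shows "0 < 1 / 2 * (real k - 1) * (real k - real m) + real k / 2 * (real m - real k)\<^sup>2"
proof -
  define d where "d = real m - real k"
  have d: "1 \<le> d" and m: "real m = real k + d"
    using assms by (auto simp: d_def)
  \<comment> \<open>Integrality enters here: \<open>d\<close> is at least 1, not merely
    positive.\<close>
  have "real k \<le> real k * d"
    using mult_left_mono[OF d, of "real k"] by simp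
  then have "0 < d / 2 * (real k * d - (real k - 1))"
    using d by (intro mult_pos_pos) auto
  then show ?thesis
    unfolding m by (simp add: power2_eq_square field_simps)
qed

text \<open>With \<open>d = k - m\<close>, right side minus left side is
  \<open>d / 2 * (k * d - k + d)\<close>. At \<open>d = 1\<close> the margin is 1/2, as for
  deletion: this value of \<open>lam\<close> balances the two directions.\<close>

lemma penalty_beats_insertion:
  fixes k m :: nat
  assumes "m < k"
  shows "1 / 2 * (((real k)\<^sup>2 - real k) - ((real m)\<^sup>2 - real m))
       < 1 / 2 * (real k - 1) * (real k - real m) + real k / 2 * (real m - real k)\<^sup>2"
proof -
  define d where "d = real k - real m"
  have d: "1 \<le> d" and m: "real m = real k - d"
    using assms by (auto simp: d_def)
  have "real k \<le> real k * d"
    using mult_left_mono[OF d, of "real k"] by simp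
  then have "0 < d / 2 * (real k * d - real k + d)"
    using d by (intro mult_pos_pos) auto
  then show ?thesis
    unfolding m by (simp add: power2_eq_square field_simps)
qed

lemma sks_al_obj_feasible:
  "ones_vec n \<bullet> x = real k \<Longrightarrow> sks_al_obj n A k lam mu x = sks_obj A x"
  by (simp add: sks_al_obj_def sks_obj_def)

text \<open>Nonnegative entries handle deletion; the entrywise bound by the complete graph handles
  insertion.\<close>

lemma infeasible_strictly_beaten:
  fixes A :: "real mat"
  assumes A: "A \<in> carrier_mat n n"
    and nonneg: "\<And>i j. i < n \<Longrightarrow> j < n \<Longrightarrow> 0 \<le> A $$ (i, j)"
    and le: "\<And>i j. i < n \<Longrightarrow> j < n \<Longrightarrow> A $$ (i, j) \<le> of_bool (i \<noteq> j)"
    and "k \<le> n" and "x \<in> binary_vecs n" and "ones_vec n \<bullet> x \<noteq> real k"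
  obtains y where "y \<in> binary_vecs n" and "ones_vec n \<bullet> y = real k"
    and "sks_obj A y < sks_al_obj n A k (1 / 2 * (real k - 1)) (real k) x"
proof -
  obtain S where S: "S \<subseteq> {..<n}" and x: "x = indicator_vec n S"
    using \<open>x \<in> binary_vecs n\<close> by (rule binary_vecs_cases)
  have finS: "finite S"
    using S finite_subset by blast
  have "card S \<noteq> k"
    using assms(6) ones_vec_scalar_prod_indicator_vec[OF S] x by simp
  define penalty where
    "penalty = 1 / 2 * (real k - 1) * (real k - real (card S))
       + real k / 2 * (real (card S) - real k)\<^sup>2"
  have al: "sks_al_obj n A k (1 / 2 * (real k - 1)) (real k) x
      = 1 / 2 * (\<Sum>p\<in>S \<times> S. A $$ p) + penalty"
    by (simp add: sks_al_obj_def penalty_def x quadratic_form_indicator_vec[OF A S]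
        ones_vec_scalar_prod_indicator_vec[OF S])
  \<comment> \<open>\<open>T\<close> is chosen nested with \<open>S\<close>, which makes the two
    sums comparable.\<close>
  obtain T where T: "T \<subseteq> {..<n}" "card T = k"
    and less: "1 / 2 * (\<Sum>p\<in>T \<times> T. A $$ p) < 1 / 2 * (\<Sum>p\<in>S \<times> S. A $$ p) + penalty"
  proof (cases "k < card S")
    case True
    obtain T where T: "T \<subseteq> S" "card T = k"
      using obtain_subset_with_card_n[of k S] True by auto
    have "(\<Sum>p\<in>T \<times> T. A $$ p) \<le> (\<Sum>p\<in>S \<times> S. A $$ p)"
      using S T finS by (intro sum_mono2) (simp, blast, force intro: nonneg)
    moreover have "0 < penalty"
      unfolding penalty_def using True by (rule penalty_beats_deletion)
    ultimately show ?thesis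
      using S T by (intro that[of T]) auto
  next
    case False
    with \<open>card S \<noteq> k\<close> have less: "card S < k"
      by simp
    \<comment> \<open>By \<open>k \<le> n\<close> there is room to enlarge \<open>S\<close> to
      \<open>k\<close> indices.\<close>
    obtain T where T: "S \<subseteq> T" "T \<subseteq> {..<n}" "card T = k"
      using exists_subset_between[of S k "{..<n}"] S less \<open>k \<le> n\<close> by auto
    have "(\<Sum>p\<in>T \<times> T. A $$ p) - (\<Sum>p\<in>S \<times> S. A $$ p)
        \<le> ((real (card T))\<^sup>2 - real (card T)) - ((real (card S))\<^sup>2 - real (card S))"
      using T by (intro sum_square_growth le) (auto intro: finite_subset)
    moreover have "1 / 2 * (((real k)\<^sup>2 - real k) - ((real (card S))\<^sup>2 - real (card S))) < penalty"
      unfolding penalty_def using less by (rule penalty_beats_insertion)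
    ultimately show ?thesis
      using T by (intro that[of T]) auto
  qed
  show ?thesis
  proof (rule that[of "indicator_vec n T"])
    show "ones_vec n \<bullet> indicator_vec n T = real k"
      using T by (simp add: ones_vec_scalar_prod_indicator_vec)
    show "sks_obj A (indicator_vec n T)
        < sks_al_obj n A k (1 / 2 * (real k - 1)) (real k) x"
      using less unfolding al sks_obj_def quadratic_form_indicator_vec[OF A T(1)] .
  qed (rule indicator_vec_in_binary_vecs)
qed

lemma adjacency_matrix_carrier: "adjacency_matrix n G \<in> carrier_mat n n"
  by (simp add: adjacency_matrix_def)

lemma adjacency_matrix_nonneg:
  "i < n \<Longrightarrow> j < n \<Longrightarrow> 0 \<le> adjacency_matrix n G $$ (i, j)"
  by (simp add: adjacency_matrix_def)

lemma adjacency_matrix_le_of_bool: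
  assumes "pair_graph G" and "i < n" and "j < n"
  shows "adjacency_matrix n G $$ (i, j) \<le> of_bool (i \<noteq> j)"
proof -
  interpret pair_graph G
    by fact
  \<comment> \<open>Loop-freeness makes the diagonal vanish; off it, entries are 0 or 1.\<close>
  have "(Suc i, Suc i) \<notin> parcs G"
    using no_loops[of "(Suc i, Suc i)"] by auto
  then show ?thesis
    using assms(2,3) by (auto simp: adjacency_matrix_def)
qed

theorem lemma20:
  fixes n k :: nat and G :: "nat pair_pre_digraph" and A :: "real mat" and lam mu :: real
  assumes "pair_graph G" and "pverts G = {1..n}"
    and "A = adjacency_matrix n G"
    and "0 < k" and "k \<le> n"
    and "lam = 1 / 2 * (real k - 1)" and "mu = real k"
  shows "(\<forall>xs. sks_optimal n A k xs \<longrightarrow>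
            (\<forall>x \<in> binary_vecs n. ones_vec n \<bullet> x \<noteq> real k \<longrightarrow>
               1 / 2 * (xs \<bullet> (A *\<^sub>v xs))
                 < 1 / 2 * (x \<bullet> (A *\<^sub>v x)) + lam * (real k - ones_vec n \<bullet> x)
                   + mu / 2 * (ones_vec n \<bullet> x - real k)\<^sup>2))
       \<and> (\<forall>x. sks_al_optimal n A k lam mu x \<longrightarrow> sks_optimal n A k x)"
proof -
  have beaten: "\<exists>y. y \<in> binary_vecs n \<and> ones_vec n \<bullet> y = real k
      \<and> sks_obj A y < sks_al_obj n A k lam mu x"
    if "x \<in> binary_vecs n" and "ones_vec n \<bullet> x \<noteq> real k" for x
    unfolding assms(3,6,7)
    by (rule infeasible_strictly_beaten[OF adjacency_matrix_carrier adjacency_matrix_nonneg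
          adjacency_matrix_le_of_bool[OF assms(1)] assms(5) that]) blast+
  \<comment> \<open>Claim (i): \<open>xs\<close> is no worse than the feasible point that beats
    \<open>x\<close>.\<close>
  have "sks_obj A xs < sks_al_obj n A k lam mu x"
    if "sks_optimal n A k xs" and "x \<in> binary_vecs n" and "ones_vec n \<bullet> x \<noteq> real k" for xs x
    using beaten[OF that(2,3)] that(1)
    by (fastforce simp: sks_optimal_def is_arg_min_linorder)
  moreover have "sks_optimal n A k x" if opt: "sks_al_optimal n A k lam mu x" for x
  proof -
    have x: "x \<in> binary_vecs n"
      and min: "\<And>y. y \<in> binary_vecs n \<Longrightarrow> sks_al_obj n A k lam mu x \<le> sks_al_obj n A k lam mu y"
      using opt by (auto simp: sks_al_optimal_def is_arg_min_linorder)
    \<comment> \<open>Were \<open>x\<close> infeasible, some feasible \<open>y\<close> would beat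
      it. As the penalty vanishes at \<open>y\<close>, this \<open>y\<close> would also have a
      smaller relaxed objective, against \<open>min\<close>.\<close>
    have feasible: "ones_vec n \<bullet> x = real k"
      using beaten[OF x] min by (force simp: sks_al_obj_feasible)
    \<comment> \<open>Both points are feasible, so the two objectives agree on them and minimality
      carries over.\<close>
    have "sks_obj A x \<le> sks_obj A y"
      if "y \<in> binary_vecs n" and "ones_vec n \<bullet> y = real k" for y
      using min[OF that(1)] feasible that(2) by (simp add: sks_al_obj_feasible)
    then show ?thesis
      using x feasible by (simp add: sks_optimal_def is_arg_min_linorder)
  qed
  ultimately show ?thesis
    unfolding sks_obj_def sks_al_obj_def by blast
qed

end
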